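(* Let $n\ge 2$ and let $b\in B_n$ be an essential braid. Then the Krammer polynomial of $b$ is equal to zero, i.e. $\det(K(b)-I)=0$, where $K$ is the Krammer representation of $B_n$ and $I$ is the identity matrix of size $\binom{n}{2}$.
   Context: $B_n$ is the braid group on $n$ strands with Artin generators $\sigma_1,\dots,\sigma_{n-1}$ (relations $\sigma_i\sigma_j=\sigma_j\sigma_i$ for $|i-j|>1$ and $\sigma_i\sigma_{i+1}\sigma_i=\sigma_{i+1}\sigma_i\sigma_{i+1}$). Essential braid: $b\in B_n$ is essential if at least one of the generators does not occur in it, i.e. there is $i\in\{1,\dots,n-1\}$ such that $b$ belongs to the subgroup $\langle \sigma_1,\dots,\sigma_{i-1},\sigma_{i+1},\dots,\sigma_{n-1}\rangle$ of $B_n$. Krammer representation: let $F_m$ be the free module of rank $m=\binom n2$ over $\mathbb{Z}[q^{\pm1},t^{\pm1}]$ with basis $\{e_{i,j}\}_{1\le i<j\le n}$. The Krammer representation $K:B_n\to \mathrm{Aut}(F_m)=GL_m(\mathbb{Z}[q^{\pm1},t^{\pm1}])$ is given by $$K(\sigma_k)(e_{i,j})=\begin{cases} tq^2e_{k,k+1} & i=k,\ j=k+1;\\ (1-q)e_{i,k}+qe_{i,k+1} & j=k,\ i<k;\\ e_{i,k}+tq^{k-i+1}(q-1)e_{k,k+1} & j=k+1,\ i<k;\\ tq(q-1)e_{k,k+1}+qe_{k+1,j} & i=k,\ k+1<j;\\ e_{k,j}+(1-q)e_{k+1,j} & i=k+1,\ k+1<j;\\ e_{i,j} & i<j<k \text{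 or } k+1<i<j;\\ e_{i,j}+tq^{k-i}(q-1)^2e_{k,k+1} & i<k<k+1<j.\end{cases}$$ As a matrix, $K(\sigma_k)$ is written with the coordinates of $K(\sigma_k)(e_{i,j})$ in the row indexed by $(i,j)$, and $K$ of a word is the corresponding product of matrices. The Krammer polynomial of a braid $b\in B_n$ is $\det(K(b)-I)\in\mathbb{Z}[q^{\pm1},t^{\pm1}]$. *)

theory Defs
  imports
    "HOL-Library.Poly_Mapping"
    "HOL-Library.Product_Plus"
    "HOL-Algebra.Generated_Groups"
    "Jordan_Normal_Form.Determinant"
begin

section \<open>Braid groups\<close>

text \<open>The letter \<open>(i, True)\<close> stands for the Artin generator \<open>\<sigma>\<^sub>i\<close> and
  \<open>(i, False)\<close> for its inverse.\<close>

type_synonym braid_word = "(nat \<times> bool) list"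

definition braid_words :: "nat \<Rightarrow> braid_word set" where
  "braid_words n = lists ({1..<n} \<times> UNIV)"

inductive_set braid_equiv :: "nat \<Rightarrow> (braid_word \<times> braid_word) set" for n :: nat where
  refl: "w \<in> braid_words n \<Longrightarrow> (w, w) \<in> braid_equiv n"
| sym: "(u, v) \<in> braid_equiv n \<Longrightarrow> (v, u) \<in> braid_equiv n"
| trans: "(u, v) \<in> braid_equiv n \<Longrightarrow> (v, w) \<in> braid_equiv n \<Longrightarrow> (u, w) \<in> braid_equiv n"
| append: "(u, u') \<in> braid_equiv n \<Longrightarrow> (v, v') \<in> braid_equiv n \<Longrightarrow>
    (u @ v, u' @ v') \<in> braid_equiv n"
| cancel: "i \<in> {1..<n} \<Longrightarrow> ([(i, s), (i, \<not> s)], []) \<in> braid_equiv n"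
| commute: "i \<in> {1..<n} \<Longrightarrow> j \<in> {1..<n} \<Longrightarrow> i + 1 < j \<Longrightarrow>
    ([(i, True), (j, True)], [(j, True), (i, True)]) \<in> braid_equiv n"
| braid: "i \<in> {1..<n} \<Longrightarrow> i + 1 \<in> {1..<n} \<Longrightarrow>
    ([(i, True), (i + 1, True), (i, True)], [(i + 1, True), (i, True), (i + 1, True)])
      \<in> braid_equiv n"

definition braid_group :: "nat \<Rightarrow> braid_word set monoid" where
  "braid_group n =
    \<lparr>carrier = braid_words n // braid_equiv n,
     monoid.mult = (\<lambda>a b. \<Union>u\<in>a. \<Union>v\<in>b. braid_equiv n `` {u @ v}),
     one = braid_equiv n `` {[]}\<rparr>"

definition artin_gen :: "nat \<Rightarrow> nat \<Rightarrow> braid_word set" where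
  "artin_gen n i = braid_equiv n `` {[(i, True)]}"

definition essential :: "nat \<Rightarrow> braid_word set \<Rightarrow> bool" where
  "essential n b \<longleftrightarrow>
    (\<exists>i\<in>{1..<n}. b \<in> generate (braid_group n) (artin_gen n ` ({1..<n} - {i})))"

lemma braid_equiv_words: "(u, v) \<in> braid_equiv n \<Longrightarrow> u \<in> braid_words n \<and> v \<in> braid_words n"
  by (induction rule: braid_equiv.induct) (auto simp: braid_words_def)

lemma equiv_braid_equiv: "equiv (braid_words n) (braid_equiv n)"
proof (rule equivI)
  show "braid_equiv n \<subseteq> braid_words n \<times> braid_words n"
    using braid_equiv_words by auto
  show "refl_on (braid_words n) (braid_equiv n)"
    by (auto intro!: refl_onI braid_equiv.refl)
  show "sym (braid_equiv n)"
    by (auto intro!: symI braid_equiv.sym)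
  show "trans (braid_equiv n)"
    by (auto intro!: transI intro: braid_equiv.trans)
qed

lemma braid_mult_class:
  assumes "u \<in> braid_words n" "v \<in> braid_words n"
  shows "braid_equiv n `` {u} \<otimes>\<^bsub>braid_group n\<^esub> braid_equiv n `` {v} = braid_equiv n `` {u @ v}"
proof -
  have "congruent2 (braid_equiv n) (braid_equiv n) (\<lambda>u v. braid_equiv n `` {u @ v})"
    by (intro congruent2I' equiv_class_eq[OF equiv_braid_equiv] braid_equiv.append)
  from UN_equiv_class2[OF equiv_braid_equiv equiv_braid_equiv this assms] show ?thesis
    by (simp add: braid_group_def)
qed

lemma braid_word_inverse:
  assumes "w \<in> braid_words n"
  shows "\<exists>v\<in>braid_words n. (v @ w, []) \<in> braid_equiv n"
  using assms
proof (induction w)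
  case Nil
  then show ?case by (auto intro: braid_equiv.refl)
next
  case (Cons x w)
  obtain i s where x: "x = (i, s)" "i \<in> {1..<n}"
    using Cons.prems by (cases x) (auto simp: braid_words_def)
  have w: "w \<in> braid_words n"
    using Cons.prems by (auto simp: braid_words_def)
  with Cons.IH obtain v where v: "v \<in> braid_words n" "(v @ w, []) \<in> braid_equiv n"
    by blast
  have "([(i, \<not> s), (i, s)], []) \<in> braid_equiv n"
    using braid_equiv.cancel[of i n "\<not> s"] x by simp
  from braid_equiv.append[OF braid_equiv.refl[OF v(1)]
      braid_equiv.append[OF this braid_equiv.refl[OF w]]]
  have "((v @ [(i, \<not> s)]) @ x # w, v @ w) \<in> braid_equiv n"
    using x by simp
  with v(2) have "((v @ [(i, \<not> s)]) @ x # w, []) \<in> braid_equiv n"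
    by (blast intro: braid_equiv.trans)
  moreover have "v @ [(i, \<not> s)] \<in> braid_words n"
    using v(1) x(2) by (auto simp: braid_words_def)
  ultimately show ?case by blast
qed

lemma group_braid_group: "group (braid_group n)"
proof -
  have car: "x \<in> carrier (braid_group n) \<longleftrightarrow> (\<exists>w\<in>braid_words n. x = braid_equiv n `` {w})" for x
    by (auto simp: braid_group_def quotient_def)
  have one: "\<one>\<^bsub>braid_group n\<^esub> = braid_equiv n `` {[]}"
    by (simp add: braid_group_def)
  have nil: "[] \<in> braid_words n"
    and app: "\<And>u v. u \<in> braid_words n \<Longrightarrow> v \<in> braid_words n \<Longrightarrow> u @ v \<in> braid_words n"
    by (auto simp: braid_words_def)
  show ?thesis
  proof (rule groupI)
    fix x assume "x \<in> carrier (braid_group n)"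
    then obtain w where w: "w \<in> braid_words n" "x = braid_equiv n `` {w}"
      by (auto simp: car)
    then obtain v where v: "v \<in> braid_words n" "(v @ w, []) \<in> braid_equiv n"
      using braid_word_inverse by blast
    then have "braid_equiv n `` {v} \<otimes>\<^bsub>braid_group n\<^esub> x = \<one>\<^bsub>braid_group n\<^esub>"
      using w equiv_class_eq[OF equiv_braid_equiv v(2)] by (simp add: braid_mult_class one)
    moreover have "braid_equiv n `` {v} \<in> carrier (braid_group n)"
      using v(1) car by blast
    ultimately show "\<exists>y\<in>carrier (braid_group n). y \<otimes>\<^bsub>braid_group n\<^esub> x = \<one>\<^bsub>braid_group n\<^esub>"
      by (rule bexI)
  next
    fix x y assume "x \<in> carrier (braid_group n)" "y \<in> carrier (braid_group n)"
    then show "x \<otimes>\<^bsub>braid_group n\<^esub> y \<in> carrier (braid_group n)"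
      using app by (auto simp: car braid_mult_class)
  next
    show "\<one>\<^bsub>braid_group n\<^esub> \<in> carrier (braid_group n)"
      using nil by (auto simp: car one)
  next
    fix x y z
    assume "x \<in> carrier (braid_group n)" "y \<in> carrier (braid_group n)" "z \<in> carrier (braid_group n)"
    then show "x \<otimes>\<^bsub>braid_group n\<^esub> y \<otimes>\<^bsub>braid_group n\<^esub> z =
        x \<otimes>\<^bsub>braid_group n\<^esub> (y \<otimes>\<^bsub>braid_group n\<^esub> z)"
      by (auto simp: car braid_mult_class app)
  next
    fix x assume "x \<in> carrier (braid_group n)"
    then show "\<one>\<^bsub>braid_group n\<^esub> \<otimes>\<^bsub>braid_group n\<^esub> x = x"
      by (auto simp: car one braid_mult_class nil)
  qed
qed


section \<open>The Krammer representation\<close>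

text \<open>The ring \<open>\<int>[q\<^sup>\<plusminus>\<^sup>1, t\<^sup>\<plusminus>\<^sup>1]\<close> is the group ring of \<open>\<int> \<times> \<int>\<close>: the pair \<open>(a, b)\<close>
  is the exponent of the monomial \<open>q\<^sup>a t\<^sup>b\<close>, and multiplication is convolution.\<close>

type_synonym laurent = "(int \<times> int) \<Rightarrow>\<^sub>0 int"

definition laurent_q :: laurent where "laurent_q = Poly_Mapping.single (1, 0) 1"

definition laurent_t :: laurent where "laurent_t = Poly_Mapping.single (0, 1) 1"

text \<open>The pairs \<open>(i, j)\<close> with \<open>1 \<le> i < j \<le> n\<close> in lexicographic order; they index
  the basis vectors \<open>e\<^bsub>i,j\<^esub>\<close> and hence the rows and columns of all matrices.\<close>

definition krammer_index :: "nat \<Rightarrow> (nat \<times> nat) list" where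
  "krammer_index n = [(i, j). i \<leftarrow> [1..<n + 1], j \<leftarrow> [i + 1..<n + 1]]"

definition krammer_basis :: "nat \<Rightarrow> nat \<Rightarrow> nat \<Rightarrow> laurent vec" where
  "krammer_basis n i j =
    vec (n choose 2) (\<lambda>r. if krammer_index n ! r = (i, j) then 1 else 0)"

definition krammer_image :: "nat \<Rightarrow> nat \<Rightarrow> nat \<Rightarrow> nat \<Rightarrow> laurent vec" where
  "krammer_image n k i j =
    (let e = krammer_basis n; q = laurent_q; t = laurent_t in
     if i = k \<and> j = k + 1 then (t * q ^ 2) \<cdot>\<^sub>v e k (k + 1)
     else if j = k \<and> i < k then (1 - q) \<cdot>\<^sub>v e i k + q \<cdot>\<^sub>v e i (k + 1)
     else if j = k + 1 \<and> i < k then e i k + (t * q ^ (k - i + 1) * (q - 1)) \<cdot>\<^sub>v e k (k + 1)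
     else if i = k \<and> k + 1 < j then (t * q * (q - 1)) \<cdot>\<^sub>v e k (k + 1) + q \<cdot>\<^sub>v e (k + 1) j
     else if i = k + 1 \<and> k + 1 < j then e k j + (1 - q) \<cdot>\<^sub>v e (k + 1) j
     else if j < k \<or> k + 1 < i then e i j
     else e i j + (t * q ^ (k - i) * (q - 1) ^ 2) \<cdot>\<^sub>v e k (k + 1))"

definition krammer_gen :: "nat \<Rightarrow> nat \<Rightarrow> laurent mat" where
  "krammer_gen n k =
    mat_of_rows (n choose 2) (map (\<lambda>(i, j). krammer_image n k i j) (krammer_index n))"

definition GL_laurent :: "nat \<Rightarrow> laurent mat monoid" where
  "GL_laurent m = units_of (ring_mat TYPE(laurent) m ())"

definition krammer_word :: "nat \<Rightarrow> braid_word \<Rightarrow> laurent mat" where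
  "krammer_word n w =
    foldr (\<lambda>(k, s) M.
        (if s then krammer_gen n k else inv\<^bsub>GL_laurent (n choose 2)\<^esub> (krammer_gen n k)) * M)
      w (1\<^sub>m (n choose 2))"

text \<open>Since the Krammer matrices satisfy the braid relations, all words in the class
  \<open>b\<close> have the same matrix, which is the value at \<open>b\<close>.\<close>

definition krammer :: "nat \<Rightarrow> braid_word set \<Rightarrow> laurent mat" where
  "krammer n b = the_elem (krammer_word n ` b)"

definition krammer_polynomial :: "nat \<Rightarrow> braid_word set \<Rightarrow> laurent" where
  "krammer_polynomial n b = det (krammer n b - 1\<^sub>m (n choose 2))"

lemma krammer_index_alt:
  "krammer_index n = concat (map (\<lambda>i. map (Pair i) [i + 1..<n + 1]) [1..<n + 1])"
  unfolding krammer_index_def ..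

lemma length_krammer_index: "length (krammer_index n) = n choose 2"
proof -
  have len: "length (concat (map (\<lambda>i. map (Pair i) (f i)) xs)) = (\<Sum>i\<leftarrow>xs. length (f i))"
    for f :: "nat \<Rightarrow> nat list" and xs
    by (induction xs) auto
  have "length (krammer_index n) = (\<Sum>i\<leftarrow>[1..<n + 1]. n - i)"
    unfolding krammer_index_alt len by (simp only: length_upt diff_add_inverse2 add_diff_cancel_right)
  also have "\<dots> = (\<Sum>i = 1..<n + 1. n - i)"
    by (simp only: interv_sum_list_conv_sum_set_nat set_upt)
  also have "\<dots> = (\<Sum>i<n. i)"
    by (rule sum.reindex_bij_witness[of _ "\<lambda>i. n - i" "\<lambda>i. n - i"]) auto
  also have "\<dots> = n choose 2"
    by (induction n) (auto simp: numeral_2_eq_2)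
  finally show ?thesis .
qed

lemma set_krammer_index: "set (krammer_index n) = {(i, j). 1 \<le> i \<and> i < j \<and> j \<le> n}"
proof -
  have "set (krammer_index n) = (\<Union>i\<in>{1..<n + 1}. Pair i ` {i + 1..<n + 1})"
    unfolding krammer_index_alt set_concat set_map set_upt image_image ..
  also have "\<dots> = {(i, j). 1 \<le> i \<and> i < j \<and> j \<le> n}"
    by fastforce
  finally show ?thesis .
qed

lemma distinct_krammer_index: "distinct (krammer_index n)"
proof -
  have conc: "distinct (concat (map (\<lambda>i. map (Pair i) (f i)) xs))"
    if "distinct xs" "\<forall>i. distinct (f i)" for f :: "nat \<Rightarrow> nat list" and xs
    using that by (induction xs) (auto simp: distinct_map inj_on_def)
  show ?thesis
    unfolding krammer_index_alt
    using conc[of "[1..<n + 1]" "\<lambda>i. [i + 1..<n + 1]"] distinct_upt by blast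
qed

end

theory Submission imports Defs begin
text \<open>If \<open>\<sigma>\<^sub>i\<close> does not occur in \<open>b\<close>, then \<open>K(b)\<close> fixes the column vector with entry \<open>q\<^bsup>i-a\<^esup>\<close>
  at \<open>(a, c)\<close> if \<open>a \<le> i < c\<close> and 0 otherwise: it vanishes at \<open>(k, k + 1)\<close> for \<open>k \<noteq> i\<close>, so the
  terms with \<open>e\<^bsub>k,k+1\<^esub>\<close> in \<open>K(\<sigma>\<^sub>k)\<close> do not contribute, and the remaining ones only move
  an index inside one of the blocks \<open>{1..i}\<close> and \<open>{i+1..n}\<close>. Its entry at \<open>(i, i + 1)\<close> is 1, hence
  \<open>K(b) - I\<close> is singular.

  That \<open>K\<close> is well defined is checked on columns, regarded as functions \<open>f\<close> of \<open>(i, j)\<close> that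
  extend linearly to functionals with \<open>f(e\<^bsub>i,j\<^esub>) = f i j\<close>. The matrices are invertible because
  they are annihilated by \<open>(X - 1)(X + q)(X - tq\<^sup>2)\<close>, whose constant term is a unit.\<close>

section \<open>The dual action and its ring identities\<close>

text \<open>Pullback of functionals along K(\<sigma>_k). Over an arbitrary commutative ring,
  \<open>q\<close> and \<open>t\<close> are plain variables, so the identities below are ring
  arithmetic.\<close>

definition krammer_dual :: "'a::comm_ring_1 \<Rightarrow> 'a \<Rightarrow> nat \<Rightarrow> (nat \<Rightarrow> nat \<Rightarrow> 'a) \<Rightarrow> nat \<Rightarrow> nat \<Rightarrow> 'a" where
  "krammer_dual q t k f i j =
    (if i = k \<and> j = k + 1 then t * q ^ 2 * f k (k + 1)
     else if j = k \<and> i < k then (1 - q) * f i k + q * f i (k + 1)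
     else if j = k + 1 \<and> i < k then f i k + t * q ^ (k - i + 1) * (q - 1) * f k (k + 1)
     else if i = k \<and> k + 1 < j then t * q * (q - 1) * f k (k + 1) + q * f (k + 1) j
     else if i = k + 1 \<and> k + 1 < j then f k j + (1 - q) * f (k + 1) j
     else if j < k \<or> k + 1 < i then f i j
     else f i j + t * q ^ (k - i) * (q - 1) ^ 2 * f k (k + 1))"

text \<open>K(\<sigma>_k) scales e_{k,k+1} by tq^2, and modulo that vector it satisfies (X - 1)(X +
  q) = 0: the remaining basis vectors are fixed or lie in 2x2 blocks of trace 1 - q and determinant
  -q. The product of the two factors, solved for X^3, gives the coefficients.\<close>

lemma krammer_dual_cubic:
  fixes q t :: "'a::comm_ring_1" and k :: nat
  assumes "i < j"
  defines "T \<equiv> krammer_dual q t k"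
  shows "T (T (T f)) i j = (1 - q + t * q ^ 2) * T (T f) i j
    + (q + t * q ^ 3 - t * q ^ 2) * T f i j - t * q ^ 3 * f i j"
proof -
  \<comment> \<open>Writing k as i + 1 + e turns the truncated exponents k - i into genuine sums
    before ring normalisation.\<close>
  consider e where "k = i + 1 + e" | "i = k" | "i = k + 1" | "k + 1 < i" by atomize_elim presburger
  then show ?thesis
    using assms(1) unfolding T_def
    by cases (auto simp: krammer_dual_def algebra_simps power2_eq_square power3_eq_cube)
qed

lemma krammer_dual_commute:
  fixes q t :: "'a::comm_ring_1"
  assumes "i < j" "k + 1 < l"
  shows "krammer_dual q t k (krammer_dual q t l f) i j = krammer_dual q t l (krammer_dual q t k f) i j"
proof -
  obtain d where l: "l = k + 2 + d" using assms(2) by (metis add_2_eq_Suc' add_Suc_right less_iff_Suc_add add.commute Suc_eq_plus1 add_Suc)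
  consider e where "k = i + 1 + e" | "i = k" | "i = k + 1" | e where "i = k + 2 + e" "e < d" | "i = l" | "i = l + 1" | "l + 1 < i"
   using l by atomize_elim presburger
  then show ?thesis
    using assms(1) unfolding l
    by cases (auto simp: krammer_dual_def algebra_simps power2_eq_square power_add Suc_diff_le)
qed

lemma krammer_dual_braid:
  fixes q t :: "'a::comm_ring_1"
  assumes "i < j"
  defines "T \<equiv> krammer_dual q t"
  shows "T k (T (k + 1) (T k f)) i j = T (k + 1) (T k (T (k + 1) f)) i j"
proof -
  consider e where "k = i + 1 + e" | "i = k" | "i = k + 1" | "i = k + 2" | "k + 2 < i" by atomize_elim presburger
  then show ?thesis
    using assms(1) unfolding T_def
    by cases (auto simp: krammer_dual_def algebra_simps power2_eq_square power3_eq_cube)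
qed

section \<open>Column vectors as functions of index pairs\<close>

lemma smult_mult_mat_vec:
  fixes A :: "'a::comm_semiring_0 mat"
  assumes "A \<in> carrier_mat m n" "v \<in> carrier_vec n"
  shows "(c \<cdot>\<^sub>m A) *\<^sub>v v = c \<cdot>\<^sub>v (A *\<^sub>v v)"
  using assms by (intro eq_vecI) auto

definition pair_vec :: "nat \<Rightarrow> (nat \<Rightarrow> nat \<Rightarrow> 'a) \<Rightarrow> 'a vec" where
  "pair_vec n f = vec (n choose 2) (\<lambda>r. case krammer_index n ! r of (i, j) \<Rightarrow> f i j)"

lemma pair_vec_carrier [simp]: "pair_vec n f \<in> carrier_vec (n choose 2)"
  by (simp add: pair_vec_def)

lemma pair_vec_cong:
  assumes "\<And>i j. 1 \<le> i \<Longrightarrow> i < j \<Longrightarrow> j \<le> n \<Longrightarrow> f i j = g i j"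
  shows "pair_vec n f = pair_vec n g"
proof (rule eq_vecI)
  fix r assume "r < dim_vec (pair_vec n g)"
  then have r: "r < n choose 2" by (simp add: pair_vec_def)
  then have "krammer_index n ! r \<in> set (krammer_index n)"
    by (simp add: length_krammer_index)
  then show "pair_vec n f $ r = pair_vec n g $ r"
    using r assms by (auto simp: pair_vec_def set_krammer_index)
qed (simp add: pair_vec_def)

lemma pair_vec_surj:
  assumes "v \<in> carrier_vec (n choose 2)"
  obtains f where "v = pair_vec n f"
proof
  let ?pos = "\<lambda>p. THE r. r < n choose 2 \<and> krammer_index n ! r = p"
  have "?pos (krammer_index n ! r) = r" if "r < n choose 2" for r
    using that distinct_krammer_index[of n]
    by (intro the_equality) (auto simp: nth_eq_iff_index_eq length_krammer_index)
  then show "v = pair_vec n (\<lambda>i j. v $ ?pos (i, j))"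
    using assms by (intro eq_vecI) (auto simp: pair_vec_def split: prod.split)
qed

lemma krammer_basis_carrier [simp]: "krammer_basis n i j \<in> carrier_vec (n choose 2)"
  by (simp add: krammer_basis_def)

lemma krammer_basis_scalar_prod:
  assumes "1 \<le> i" "i < j" "j \<le> n"
  shows "krammer_basis n i j \<bullet> pair_vec n f = f i j"
proof -
  have "(i, j) \<in> set (krammer_index n)"
    using assms by (simp add: set_krammer_index)
  then obtain r where r: "r < n choose 2" "krammer_index n ! r = (i, j)"
    by (metis in_set_conv_nth length_krammer_index)
  have "krammer_index n ! s = (i, j) \<longleftrightarrow> s = r" if "s < n choose 2" for s
    using that r distinct_krammer_index[of n]
    by (metis nth_eq_iff_index_eq length_krammer_index)
  then have "krammer_basis n i j = unit_vec (n choose 2) r"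
    by (intro eq_vecI) (auto simp: krammer_basis_def unit_vec_def)
  then show ?thesis
    using r by (simp add: pair_vec_def)
qed

lemma krammer_image_carrier [simp]: "krammer_image n k i j \<in> carrier_vec (n choose 2)"
  by (simp add: krammer_image_def Let_def)

text \<open>The range of \<open>k\<close> keeps every basis vector in the image, in particular
  e_{k,k+1}, within the index list, so each one evaluates \<open>f\<close> at its own pair.\<close>

lemma krammer_image_scalar_prod:
  assumes "k \<in> {1..<n}" "1 \<le> i" "i < j" "j \<le> n"
  shows "krammer_image n k i j \<bullet> pair_vec n f = krammer_dual laurent_q laurent_t k f i j"
proof -
  have dim [simp]: "dim_vec (krammer_basis n i j) = n choose 2"
    "dim_vec (pair_vec n f) = n choose 2" for i j
    by (simp_all add: krammer_basis_def pair_vec_def)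
  have add: "(u + v) \<bullet> pair_vec n f = u \<bullet> pair_vec n f + v \<bullet> pair_vec n f"
    if "u \<in> carrier_vec (n choose 2)" "v \<in> carrier_vec (n choose 2)" for u v
    using that by (intro add_scalar_prod_distrib) auto
  show ?thesis
    using assms
    by (auto simp: krammer_image_def krammer_dual_def Let_def add krammer_basis_scalar_prod)
qed

section \<open>Generator matrices: braid relations and invertibility\<close>

lemma krammer_gen_carrier [simp]:
  "krammer_gen n k \<in> carrier_mat (n choose 2) (n choose 2)"
  by (rule carrier_matI) (simp_all add: krammer_gen_def length_krammer_index)

text \<open>The rows of the matrix are the images of the basis vectors, so acting on columns is
  pullback, and matrix products become compositions of \<open>krammer_dual\<close> in the same
  order.\<close>

lemma krammer_gen_mult_pair_vec:
  assumes "k \<in> {1..<n}"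
  shows "krammer_gen n k *\<^sub>v pair_vec n f = pair_vec n (krammer_dual laurent_q laurent_t k f)"
proof (rule eq_vecI)
  fix r assume "r < dim_vec (pair_vec n (krammer_dual laurent_q laurent_t k f))"
  then have r: "r < n choose 2" by (simp add: pair_vec_def)
  obtain i j where ij: "krammer_index n ! r = (i, j)" by fastforce
  then have "(i, j) \<in> set (krammer_index n)"
    using r by (metis nth_mem length_krammer_index)
  then have "krammer_image n k i j \<bullet> pair_vec n f = krammer_dual laurent_q laurent_t k f i j"
    using assms by (intro krammer_image_scalar_prod) (auto simp: set_krammer_index)
  moreover have "row (krammer_gen n k) r = krammer_image n k i j"
    unfolding krammer_gen_def using r ij by (subst mat_of_rows_row) (auto simp: length_krammer_index)
  moreover have "dim_row (krammer_gen n k) = n choose 2"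
    using krammer_gen_carrier by blast
  ultimately show "(krammer_gen n k *\<^sub>v pair_vec n f) $ r =
      pair_vec n (krammer_dual laurent_q laurent_t k f) $ r"
    using r ij by (simp add: pair_vec_def)
next
  have "dim_row (krammer_gen n k) = n choose 2"
    using krammer_gen_carrier by blast
  then show "dim_vec (krammer_gen n k *\<^sub>v pair_vec n f) =
      dim_vec (pair_vec n (krammer_dual laurent_q laurent_t k f))"
    by (simp add: pair_vec_def)
qed

text \<open>Each unit vector is some \<open>pair_vec\<close>, so all columns agree. This reduces
  matrix identities to pointwise identities of \<open>krammer_dual\<close>.\<close>

lemma mat_eqI_mult_pair_vec:
  fixes A B :: "'a::comm_ring_1 mat"
  assumes A: "A \<in> carrier_mat (n choose 2) (n choose 2)"
    and B: "B \<in> carrier_mat (n choose 2) (n choose 2)"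
    and eq: "\<And>f. A *\<^sub>v pair_vec n f = B *\<^sub>v pair_vec n f"
  shows "A = B"
proof (rule eq_matI)
  fix r s assume "r < dim_row B" "s < dim_col B"
  then have rs: "r < n choose 2" "s < n choose 2" using B by auto
  obtain f where "unit_vec (n choose 2) s = (pair_vec n f :: 'a vec)"
    using pair_vec_surj[of "unit_vec (n choose 2) s" n] by auto
  then have "A *\<^sub>v unit_vec (n choose 2) s = B *\<^sub>v unit_vec (n choose 2) s"
    using eq by simp
  then have "(A *\<^sub>v unit_vec (n choose 2) s) $ r = (B *\<^sub>v unit_vec (n choose 2) s) $ r"
    by simp
  then show "A $$ (r, s) = B $$ (r, s)"
    using A B rs by simp
qed (use A B in auto)

lemma krammer_gen_commute:
  assumes "k \<in> {1..<n}" "l \<in> {1..<n}" "k + 1 < l"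
  shows "krammer_gen n k * krammer_gen n l = krammer_gen n l * krammer_gen n k"
  using assms
  by (intro mat_eqI_mult_pair_vec[of _ n])
    (auto simp: assoc_mult_mat_vec[of _ "n choose 2" "n choose 2" _ "n choose 2"]
      krammer_gen_mult_pair_vec mult_carrier_mat[of _ _ "n choose 2"]
      intro!: pair_vec_cong krammer_dual_commute)

text \<open>The brackets nest to the right as in the products that \<open>krammer_word\<close>
  builds.\<close>

lemma krammer_gen_braid:
  assumes "k \<in> {1..<n}" "k + 1 \<in> {1..<n}"
  shows "krammer_gen n k * (krammer_gen n (k + 1) * krammer_gen n k) =
    krammer_gen n (k + 1) * (krammer_gen n k * krammer_gen n (k + 1))"
  using assms
  by (intro mat_eqI_mult_pair_vec[of _ n])
    (auto simp: assoc_mult_mat_vec[of _ "n choose 2" "n choose 2" _ "n choose 2"]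
      krammer_gen_mult_pair_vec mult_carrier_mat[of _ _ "n choose 2"]
      krammer_dual_braid[simplified] intro!: pair_vec_cong)

lemma laurent_unit: "\<exists>u. u * (laurent_t * laurent_q ^ 3) = 1"
proof
  have "laurent_t * laurent_q ^ 3 = Poly_Mapping.single (3, 1) 1"
    by (simp add: laurent_t_def laurent_q_def mult_single power3_eq_cube)
  then show "Poly_Mapping.single (-3, -1) 1 * (laurent_t * laurent_q ^ 3) = 1"
    by (simp add: mult_single zero_prod_def flip: single_one)
qed

lemma krammer_gen_Units:
  assumes k: "k \<in> {1..<n}"
  shows "krammer_gen n k \<in> Units (ring_mat TYPE(laurent) (n choose 2) ())"
proof -
  let ?N = "n choose 2" and ?q = laurent_q and ?t = laurent_t
  let ?M = "krammer_gen n k" and ?T = "krammer_dual laurent_q laurent_t k"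
  obtain u where u: "u * (?t * ?q ^ 3) = 1" using laurent_unit ..
  define a where "a = 1 - ?q + ?t * ?q ^ 2"
  define b where "b = ?q + ?t * ?q ^ 3 - ?t * ?q ^ 2"
  \<comment> \<open>The cubic reads M^3 = a M^2 + b M - tq^3, that is (a M + b - M^2) M = tq^3;
    dividing by the unit tq^3 yields the inverse.\<close>
  define Q where "Q = u \<cdot>\<^sub>m (a \<cdot>\<^sub>m ?M + b \<cdot>\<^sub>m 1\<^sub>m ?N - ?M * ?M)"
  have M: "?M \<in> carrier_mat ?N ?N" and MM: "?M * ?M \<in> carrier_mat ?N ?N"
    by (simp_all add: mult_carrier_mat[OF krammer_gen_carrier krammer_gen_carrier])
  have Q: "Q \<in> carrier_mat ?N ?N"
    unfolding Q_def by (intro smult_carrier_mat minus_carrier_mat MM)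
  \<comment> \<open>As a polynomial in M, \<open>Q\<close> commutes with M, so a left inverse is
    also a right inverse.\<close>
  have comm: "?M * Q = Q * ?M"
    unfolding Q_def using M MM
    by (simp add: minus_carrier_mat left_mult_one_mat[OF M] right_mult_one_mat[OF M] mult_smult_distrib[of _ ?N ?N _ ?N] mult_smult_assoc_mat[of _ ?N ?N _ ?N]
        mult_add_distrib_mat[of _ ?N ?N _ ?N] add_mult_distrib_mat[of _ ?N ?N _ _ ?N]
        mult_minus_distrib_mat[of _ ?N ?N _ ?N] minus_mult_distrib_mat[of _ ?N ?N _ _ ?N]
        assoc_mult_mat[of _ ?N ?N _ ?N _ ?N])
  have "Q * ?M = 1\<^sub>m ?N"
  proof (rule mat_eqI_mult_pair_vec)
    fix f
    have "Q *\<^sub>v pair_vec n (?T f) = u \<cdot>\<^sub>v (a \<cdot>\<^sub>v pair_vec n (?T (?T f)) + b \<cdot>\<^sub>v pair_vec n (?T f)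
        - pair_vec n (?T (?T (?T f))))"
      unfolding Q_def using M MM k
      by (simp add: minus_carrier_mat smult_mult_mat_vec[of _ ?N ?N]
          add_mult_distrib_mat_vec[of _ ?N ?N] minus_mult_distrib_mat_vec[of _ ?N ?N]
          assoc_mult_mat_vec[of _ ?N ?N _ ?N] krammer_gen_mult_pair_vec)
    also have "\<dots> = pair_vec n (\<lambda>i j. u * (a * ?T (?T f) i j + b * ?T f i j - ?T (?T (?T f)) i j))"
      by (intro eq_vecI) (auto simp: pair_vec_def split: prod.split)
    also have "\<dots> = pair_vec n f"
    proof (rule pair_vec_cong)
      fix i j :: nat assume "i < j"
      from krammer_dual_cubic[OF this, of ?q ?t k f]
      have "u * (a * ?T (?T f) i j + b * ?T f i j - ?T (?T (?T f)) i j) =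
          u * (?t * ?q ^ 3) * f i j"
        by (simp add: a_def b_def mult.assoc)
      then show "u * (a * ?T (?T f) i j + b * ?T f i j - ?T (?T (?T f)) i j) = f i j"
        by (simp add: u)
    qed
    finally show "Q * ?M *\<^sub>v pair_vec n f = 1\<^sub>m ?N *\<^sub>v pair_vec n f"
      using Q M k by (simp add: assoc_mult_mat_vec[of _ ?N ?N _ ?N] krammer_gen_mult_pair_vec)
  qed (use Q M in \<open>auto intro: mult_carrier_mat\<close>)
  with comm Q M show ?thesis
    by (auto simp: Units_def ring_mat_simps)
qed

section \<open>The representation on words and braid classes\<close>

definition krammer_letter :: "nat \<Rightarrow> nat \<times> bool \<Rightarrow> laurent mat" where
  "krammer_letter n = (\<lambda>(k, s). if s then krammer_gen n k
    else inv\<^bsub>GL_laurent (n choose 2)\<^esub> (krammer_gen n k))"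

lemma krammer_word_Nil: "krammer_word n [] = 1\<^sub>m (n choose 2)"
  by (simp add: krammer_word_def)

lemma krammer_word_Cons: "krammer_word n (x # w) = krammer_letter n x * krammer_word n w"
  by (simp add: krammer_word_def krammer_letter_def split: prod.split)

text \<open>Since the generator is a unit of the matrix ring, its inverse in the unit group is the
  ring inverse.\<close>

lemma krammer_gen_inverse:
  assumes k: "k \<in> {1..<n}"
  defines "M' \<equiv> inv\<^bsub>GL_laurent (n choose 2)\<^esub> (krammer_gen n k)"
  shows "M' \<in> carrier_mat (n choose 2) (n choose 2)"
    and "M' * krammer_gen n k = 1\<^sub>m (n choose 2)"
    and "krammer_gen n k * M' = 1\<^sub>m (n choose 2)"
proof -
  let ?R = "ring_mat TYPE(laurent) (n choose 2) ()"
  interpret ring ?R by (rule ring_mat)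
  have "M' = inv\<^bsub>?R\<^esub> krammer_gen n k"
    unfolding M'_def GL_laurent_def by (rule units_of_inv[OF krammer_gen_Units[OF k]])
  with krammer_gen_Units[OF k] Units_l_inv[of "krammer_gen n k"]
    Units_r_inv[of "krammer_gen n k"] Units_inv_closed[of "krammer_gen n k"]
  show "M' \<in> carrier_mat (n choose 2) (n choose 2)"
    "M' * krammer_gen n k = 1\<^sub>m (n choose 2)"
    "krammer_gen n k * M' = 1\<^sub>m (n choose 2)"
    by (simp_all add: ring_mat_simps)
qed

lemma krammer_letter_carrier:
  assumes "k \<in> {1..<n}"
  shows "krammer_letter n (k, s) \<in> carrier_mat (n choose 2) (n choose 2)"
  using krammer_gen_inverse(1)[OF assms] by (simp add: krammer_letter_def)

lemma krammer_word_carrier: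
  assumes "w \<in> braid_words n"
  shows "krammer_word n w \<in> carrier_mat (n choose 2) (n choose 2)"
  using assms
proof (induction w)
  case (Cons x w)
  then show ?case
    by (cases x) (auto simp: braid_words_def krammer_word_Cons
        intro!: mult_carrier_mat krammer_letter_carrier)
qed (simp add: krammer_word_Nil)

lemma krammer_word_append:
  assumes "u \<in> braid_words n" "v \<in> braid_words n"
  shows "krammer_word n (u @ v) = krammer_word n u * krammer_word n v"
  using assms(1)
proof (induction u)
  case Nil
  then show ?case using krammer_word_carrier[OF assms(2)] by (simp add: krammer_word_Nil)
next
  case (Cons x u)
  then obtain k s where x: "x = (k, s)" "k \<in> {1..<n}" and u: "u \<in> braid_words n"
    by (cases x) (auto simp: braid_words_def)
  then show ?case
    using Cons.IH krammer_letter_carrier[OF x(2), of s] krammer_word_carrier[OF u]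
      krammer_word_carrier[OF assms(2)]
    by (simp add: krammer_word_Cons)
qed

lemma krammer_word_equiv:
  assumes "(u, v) \<in> braid_equiv n"
  shows "krammer_word n u = krammer_word n v"
  using assms
proof (induction rule: braid_equiv.induct)
  case (append u u' v v')
  then show ?case
    using braid_equiv_words by (metis krammer_word_append)
next
  case (cancel i s)
  then show ?case
    \<comment> \<open>The sign \<open>s\<close> decides whether the left or the right inverse law
      applies.\<close>
    using krammer_gen_inverse[OF cancel]
    by (cases s) (auto simp: krammer_word_Cons krammer_word_Nil krammer_letter_def
        right_mult_one_mat[OF krammer_gen_carrier])
next
  case (commute i j)
  then show ?case
    using krammer_gen_commute[OF commute]
    by (simp add: krammer_word_Cons krammer_word_Nil krammer_letter_def
        right_mult_one_mat[OF krammer_gen_carrier])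
next
  case (braid i)
  then show ?case
    using krammer_gen_braid[OF braid]
    by (simp add: krammer_word_Cons krammer_word_Nil krammer_letter_def
        right_mult_one_mat[OF krammer_gen_carrier])
qed auto

text \<open>Well-definedness: equivalent words have equal matrices, so \<open>the_elem\<close> is
  applied to a singleton.\<close>

lemma krammer_class:
  assumes "w \<in> braid_words n"
  shows "krammer n (braid_equiv n `` {w}) = krammer_word n w"
proof -
  have "krammer_word n ` (braid_equiv n `` {w}) = {krammer_word n w}"
    using braid_equiv.refl[OF assms] by (auto dest: krammer_word_equiv)
  then show ?thesis by (simp add: krammer_def)
qed

section \<open>Words for subgroups generated by Artin generators\<close>

text \<open>For an essential braid this supplies a representative without the missing letter, on
  which induction over letters is possible.\<close>

lemma generate_artin_gen_word:
  assumes "b \<in> generate (braid_group n) (artin_gen n ` S)" and S: "S \<subseteq> {1..<n}"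
  obtains w where "w \<in> lists (S \<times> UNIV)" "b = braid_equiv n `` {w}"
proof -
  have words: "w \<in> braid_words n" if "w \<in> lists (S \<times> UNIV)" for w
    using that S by (auto simp: braid_words_def)
  interpret group "braid_group n" by (rule group_braid_group)
  from assms(1) have "\<exists>w\<in>lists (S \<times> UNIV). b = braid_equiv n `` {w}"
  proof induction
    case one
    then show ?case by (intro bexI[of _ "[]"]) (auto simp: braid_group_def)
  next
    case (incl h)
    then obtain k where "k \<in> S" "h = artin_gen n k" by blast
    then show ?case by (intro bexI[of _ "[(k, True)]"]) (auto simp: artin_gen_def)
  next
    case (inv h)
    then obtain k where k: "k \<in> S" "h = artin_gen n k" by blast
    have w: "[(k, s)] \<in> braid_words n" for s
      using k S by (auto simp: braid_words_def)
    then have car: "braid_equiv n `` {[(k, s)]} \<in> carrier (braid_group n)" for s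
      by (auto simp: braid_group_def intro: quotientI)
    \<comment> \<open>The class of the inverse letter is a left inverse of \<open>h\<close>, hence
      equal to the group inverse.\<close>
    have "([(k, False), (k, True)], []) \<in> braid_equiv n"
      using braid_equiv.cancel[of k n False] k S by auto
    from equiv_class_eq[OF equiv_braid_equiv this]
    have "braid_equiv n `` {[(k, False)]} \<otimes>\<^bsub>braid_group n\<^esub> h = \<one>\<^bsub>braid_group n\<^esub>"
      by (simp add: k artin_gen_def braid_mult_class[OF w w]) (simp add: braid_group_def)
    then have "inv\<^bsub>braid_group n\<^esub> h = braid_equiv n `` {[(k, False)]}"
      using car k by (intro inv_equality) (auto simp: artin_gen_def)
    then show ?case using k by (intro bexI[of _ "[(k, False)]"]) auto
  next
    case (eng h1 h2)
    then obtain u v where "u \<in> lists (S \<times> UNIV)" "h1 = braid_equiv n `` {u}"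
      "v \<in> lists (S \<times> UNIV)" "h2 = braid_equiv n `` {v}" by blast
    then show ?case
      by (intro bexI[of _ "u @ v"]) (auto simp: braid_mult_class words)
  qed
  with that show thesis by blast
qed

section \<open>The fixed column vector and the vanishing determinant\<close>

definition separating :: "'a::comm_ring_1 \<Rightarrow> nat \<Rightarrow> nat \<Rightarrow> nat \<Rightarrow> 'a" where
  "separating q i a b = (if a \<le> i \<and> i < b then q ^ (i - a) else 0)"

text \<open>For k > i both k and k + 1 lie right of the cut, where values depend only on
  \<open>a\<close> and the coefficients 1 - q and q add up to 1. For k < i the weights fit because q
  * q^(i-k-1) = q^(i-k) and q^(i-k) + (1-q) * q^(i-k-1) = q^(i-k-1).\<close>

lemma krammer_dual_separating:
  assumes "k \<noteq> i" "a < b"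
  shows "krammer_dual q t k (separating q i) a b = separating q i a b"
proof -
  consider d where "i = k + 1 + d" | "i < k"
    using assms(1) by atomize_elim presburger
  then show ?thesis
    using assms(2) by cases (auto simp: krammer_dual_def separating_def algebra_simps)
qed

lemma krammer_letter_separating:
  assumes k: "k \<in> {1..<n}" "k \<noteq> i"
  shows "krammer_letter n (k, s) *\<^sub>v pair_vec n (separating laurent_q i) =
    pair_vec n (separating laurent_q i)"
proof -
  let ?N = "n choose 2" and ?v = "pair_vec n (separating laurent_q i)"
  have M: "krammer_gen n k *\<^sub>v ?v = ?v"
    using k by (auto simp: krammer_gen_mult_pair_vec krammer_dual_separating intro: pair_vec_cong)
  let ?M' = "inv\<^bsub>GL_laurent (n choose 2)\<^esub> (krammer_gen n k)"
  \<comment> \<open>A vector fixed by a matrix is fixed by its inverse: insert the matrix, then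
    cancel.\<close>
  have "?M' *\<^sub>v ?v = ?M' *\<^sub>v (krammer_gen n k *\<^sub>v ?v)"
    by (simp add: M)
  also have "\<dots> = (?M' * krammer_gen n k) *\<^sub>v ?v"
    using krammer_gen_inverse(1)[OF k(1)]
    by (intro assoc_mult_mat_vec[of _ ?N ?N _ ?N, symmetric]) auto
  also have "\<dots> = ?v"
    by (simp add: krammer_gen_inverse(2)[OF k(1)])
  finally show ?thesis
    using M by (simp add: krammer_letter_def)
qed

lemma krammer_word_separating:
  assumes "w \<in> lists (({1..<n} - {i}) \<times> UNIV)"
  shows "krammer_word n w *\<^sub>v pair_vec n (separating laurent_q i) =
    pair_vec n (separating laurent_q i)"
  using assms
proof (induction w)
  case (Cons x w)
  then obtain k s where x: "x = (k, s)" "k \<in> {1..<n}" "k \<noteq> i"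
    by (cases x) auto
  have "w \<in> braid_words n"
    using Cons.hyps by (auto simp: braid_words_def)
  then show ?case
    using Cons.IH krammer_letter_separating[OF x(2,3)]
    by (simp add: x krammer_word_Cons assoc_mult_mat_vec[OF krammer_letter_carrier[OF x(2)]
          krammer_word_carrier])
qed (simp add: krammer_word_Nil)

text \<open>The entry 1 replaces \<open>v \<noteq> 0\<close>, so that no integral domain is needed.\<close>

lemma det_eq_0_if_kernel:
  fixes A :: "'a::comm_ring_1 mat"
  assumes A: "A \<in> carrier_mat m m" and v: "v \<in> carrier_vec m"
    and kernel: "A *\<^sub>v v = 0\<^sub>v m" and r: "r < m" "v $ r = 1"
  shows "det A = 0"
proof -
  note adj = adj_mat[OF A]
  have "det A \<cdot>\<^sub>v v = (adj_mat A * A) *\<^sub>v v"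
    using v by (simp add: adj smult_mult_mat_vec[of _ m m])
  also have "\<dots> = adj_mat A *\<^sub>v (A *\<^sub>v v)"
    by (rule assoc_mult_mat_vec[OF adj(1) A v])
  also have "\<dots> = 0\<^sub>v m"
    using adj(1) by (auto simp: kernel)
  finally have "(det A \<cdot>\<^sub>v v) $ r = 0\<^sub>v m $ r"
    by simp
  then show ?thesis using r v by simp
qed

theorem theorem1:
  fixes n :: nat and b :: "braid_word set"
  assumes "n \<ge> 2"
    and "b \<in> carrier (braid_group n)"
    and "essential n b"
  shows "krammer_polynomial n b = 0"
proof -
  let ?N = "n choose 2"
  obtain i where i: "i \<in> {1..<n}"
    and "b \<in> generate (braid_group n) (artin_gen n ` ({1..<n} - {i}))"
    using assms(3) by (auto simp: essential_def)
  then obtain w where w: "w \<in> lists (({1..<n} - {i}) \<times> UNIV)" and b: "b = braid_equiv n `` {w}"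
    by (blast elim: generate_artin_gen_word)
  then have "w \<in> braid_words n"
    by (auto simp: braid_words_def)
  then have K: "krammer n b = krammer_word n w" "krammer_word n w \<in> carrier_mat ?N ?N"
    by (simp_all add: b krammer_class krammer_word_carrier)
  let ?v = "pair_vec n (separating laurent_q i)"
  \<comment> \<open>At this pair the weight is q^0 = 1, the unit entry needed for the determinant
    criterion.\<close>
  have "(i, i + 1) \<in> set (krammer_index n)"
    using i by (auto simp: set_krammer_index)
  then obtain r where r: "r < ?N" "krammer_index n ! r = (i, i + 1)"
    by (metis in_set_conv_nth length_krammer_index)
  have "(krammer_word n w - 1\<^sub>m ?N) *\<^sub>v ?v = 0\<^sub>v ?N"
    using K(2) by (simp add: minus_mult_distrib_mat_vec[of _ ?N ?N] krammer_word_separating[OF w])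
  moreover have "?v $ r = 1"
    using r by (simp add: pair_vec_def separating_def)
  ultimately have "det (krammer_word n w - 1\<^sub>m ?N) = 0"
    using K(2) r(1) by (intro det_eq_0_if_kernel[of _ ?N ?v r]) auto
  then show ?thesis
    by (simp add: krammer_polynomial_def K(1))
qed

end
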